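(* Let $\mu=(\mu_0,\dotsc,\mu_\ell)$ be an integer partition with $\ell\geq1$, $1\leq d\leq\mu_0$, $\mu_\ell=1$ and $\mu_{\ell-1}\geq d$. Then for all $n\geq0$, \[ P_{\mu,d,n}(t)=\sum_{j\geq0}\binom{d(n-j\ell)}{j}t^j, \] and $\{P_{\mu,d,n}(t)\}_{n\geq1}$ is a Brenti sequence. In particular every $P_{\mu,d,n}(t)$ has only real nonpositive zeros.
   Context: An anchor word for $\mu$ of length $n$ is a word $a_1\cdots a_n$ over $\{1,\dotsc,d,\infty\}$ such that $a_i\neq\infty$ implies $a_{i+k}\geq a_i+\mu_k$ for $k=1,\dotsc,\ell$ ($\infty$ larger than every integer) and $a_{n-\ell+1}=\cdots=a_n=\infty$; $P_{\mu,d,n}(t)=\sum_w t^{\mathrm{bigtiles}(w)}$ over anchor words of length $n$, where $\mathrm{bigtiles}(w)$ is the number of non-$\infty$ letters. A sequence of polynomials $(P_n)_{n\geq1}$ is a Brenti sequence if there exist a locally finite directed graph $D$ with vertex set $\mathbb{N}^2$ and nonnegative edge weights, which is planar and weakly $y$-invariant (the edges, with weights, leaving $(m,k)$ do not depend on $m$ up to the translation $(m,k)\mapsto(m',k)$), and row indices $r_1,r_2,\dotsc$ such that $P_n(t)=\sum_j M_{r_n,j}t^j$ for all $n$, where $M_{N,j}$ is the weighted number of directed paths from $(0,0)$ to $(N,j)$ in $D$ (a path's weight being the product of its edge weights). *)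

theory Defs
  imports
    "HOL-Analysis.Analysis"
    "HOL-Library.Extended_Nat"
    "HOL-Computational_Algebra.Polynomial"
    "Graph_Theory.Pair_Digraph"
begin

text \<open>Partitions are nonempty lists \<open>[\<mu>\<^sub>0, \<dots>, \<mu>\<^sub>l]\<close>, so that \<open>l = length \<mu> - 1\<close>.\<close>

definition is_partition :: "nat list \<Rightarrow> bool" where
  "is_partition \<mu> \<longleftrightarrow> \<mu> \<noteq> [] \<and> sorted_wrt (\<ge>) \<mu> \<and> (\<forall>x\<in>set \<mu>. 0 < x)"

text \<open>
  Words are 0-indexed lists over \<open>{1,\<dots>,d,\<infinity>}\<close>, so that the letter \<open>a\<^sub>i\<close> is \<open>w ! (i - 1)\<close>.
  For \<open>n < l\<close> the last condition applies to every letter, i.e. the only anchor word is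
  \<open>\<infinity>\<dots>\<infinity>\<close>. The guard \<open>i + k < n\<close> only keeps list accesses in range: a finite letter has
  at least \<open>l\<close> letters after it.
\<close>

definition anchor_word :: "nat list \<Rightarrow> nat \<Rightarrow> nat \<Rightarrow> enat list \<Rightarrow> bool" where
  "anchor_word \<mu> d n w \<longleftrightarrow>
     (let l = length \<mu> - 1 in
        length w = n \<and>
        set w \<subseteq> insert \<infinity> (enat ` {1..d}) \<and>
        (\<forall>i<n. w ! i \<noteq> \<infinity> \<longrightarrow>
           (\<forall>k\<in>{1..l}. i + k < n \<longrightarrow> w ! (i + k) \<ge> w ! i + enat (\<mu> ! k))) \<and>
        (\<forall>i<n. n \<le> i + l \<longrightarrow> w ! i = \<infinity>))"

lemma finite_anchor_words: "finite {w. anchor_word \<mu> d n w}"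
  by (rule finite_subset[OF _ finite_lists_length_eq[of "insert \<infinity> (enat ` {1..d})" n]])
     (auto simp: anchor_word_def Let_def)

definition bigtiles :: "enat list \<Rightarrow> nat" where
  "bigtiles w = length (filter (\<lambda>a. a \<noteq> \<infinity>) w)"

definition anchor_poly :: "nat list \<Rightarrow> nat \<Rightarrow> nat \<Rightarrow> real poly" where
  "anchor_poly \<mu> d n = (\<Sum>w | anchor_word \<mu> d n w. monom 1 (bigtiles w))"

type_synonym lattice_digraph = "(nat \<times> nat) pair_pre_digraph"
type_synonym lattice_weight = "(nat \<times> nat) \<times> (nat \<times> nat) \<Rightarrow> real"

definition locally_finite_digraph :: "lattice_digraph \<Rightarrow> bool" where
  "locally_finite_digraph D \<longleftrightarrow>
     (\<forall>v\<in>pverts D. finite (in_arcs (with_proj D) v) \<and> finite (out_arcs (with_proj D) v))"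

definition directed_paths :: "lattice_digraph \<Rightarrow> nat \<times> nat \<Rightarrow> nat \<times> nat \<Rightarrow>
    ((nat \<times> nat) \<times> (nat \<times> nat)) list set" where
  "directed_paths D u v = {p. pre_digraph.awalk (with_proj D) u p v}"

text \<open>
  Finiteness of the sets of paths, without which the weighted path numbers would not be defined.
  It excludes directed cycles, so walks and vertex-simple paths coincide.
\<close>

definition finite_path_sets :: "lattice_digraph \<Rightarrow> bool" where
  "finite_path_sets D \<longleftrightarrow> (\<forall>u\<in>pverts D. \<forall>v\<in>pverts D. finite (directed_paths D u v))"

definition lattice_point :: "nat \<times> nat \<Rightarrow> real \<times> real" where
  "lattice_point v = (real (fst v), real (snd v))"

text \<open>
  A planar drawing: vertices sit at their lattice points, edges are simple curves which avoid
  all vertices other than their endpoints, and distinct edges meet at most in common endpoints.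
\<close>

definition planar_digraph :: "lattice_digraph \<Rightarrow> bool" where
  "planar_digraph D \<longleftrightarrow>
     (\<exists>\<gamma> :: (nat \<times> nat) \<times> (nat \<times> nat) \<Rightarrow> real \<Rightarrow> real \<times> real.
        (\<forall>e\<in>parcs D. simple_path (\<gamma> e) \<and>
           pathstart (\<gamma> e) = lattice_point (fst e) \<and>
           pathfinish (\<gamma> e) = lattice_point (snd e) \<and>
           path_image (\<gamma> e) \<inter> lattice_point ` pverts D
             \<subseteq> {lattice_point (fst e), lattice_point (snd e)}) \<and>
        (\<forall>e\<in>parcs D. \<forall>e'\<in>parcs D. e \<noteq> e' \<longrightarrow>
           path_image (\<gamma> e) \<inter> path_image (\<gamma> e')
             \<subseteq> lattice_point ` ({fst e, snd e} \<inter> {fst e', snd e'})))"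

text \<open>The edges leaving a vertex, recorded as integer displacements together with the weight.\<close>

definition out_steps ::
  "lattice_digraph \<Rightarrow> lattice_weight \<Rightarrow> nat \<times> nat \<Rightarrow> (int \<times> int \<times> real) set" where
  "out_steps D wt v =
     (\<lambda>e. (int (fst (snd e)) - int (fst v), int (snd (snd e)) - int (snd v), wt e))
       ` out_arcs (with_proj D) v"

definition weakly_y_invariant :: "lattice_digraph \<Rightarrow> lattice_weight \<Rightarrow> bool" where
  "weakly_y_invariant D wt \<longleftrightarrow> (\<forall>m m' k. out_steps D wt (m, k) = out_steps D wt (m', k))"

definition weighted_paths ::
  "lattice_digraph \<Rightarrow> lattice_weight \<Rightarrow> nat \<Rightarrow> nat \<Rightarrow> real" where
  "weighted_paths D wt N j = (\<Sum>p\<in>directed_paths D (0, 0) (N, j). prod_list (map wt p))"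

text \<open>
  Only the members \<open>P n\<close> with \<open>n \<ge> 1\<close> matter. The identity
  \<open>P\<^sub>n(t) = \<Sum>\<^sub>j M\<^sub>r\<^sub>n\<^sub>,\<^sub>j t\<^sup>j\<close>, whose right-hand side is a priori a power series, is stated
  coefficientwise.
\<close>

definition brenti_sequence :: "(nat \<Rightarrow> real poly) \<Rightarrow> bool" where
  "brenti_sequence P \<longleftrightarrow>
     (\<exists>(D :: lattice_digraph) (wt :: lattice_weight) (r :: nat \<Rightarrow> nat).
        pverts D = UNIV \<and>
        locally_finite_digraph D \<and> finite_path_sets D \<and>
        (\<forall>e\<in>parcs D. 0 \<le> wt e) \<and>
        planar_digraph D \<and>
        weakly_y_invariant D wt \<and>
        (\<forall>n\<ge>1. \<forall>j. coeff (P n) j = weighted_paths D wt (r n) j))"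

definition only_real_nonpos_zeros :: "real poly \<Rightarrow> bool" where
  "only_real_nonpos_zeros p \<longleftrightarrow>
     (\<forall>z::complex. poly (map_poly complex_of_real p) z = 0 \<longrightarrow> z \<in> \<real> \<and> Re z \<le> 0)"

end

theory Submission
  imports Defs
begin

text \<open>
  All three claims come from one Pascal-type recurrence for \<open>g N j = (N - j m choose j)\<close> with
  \<open>m = d l\<close>: \<open>g (N + 1) (j + 1) = g N (j + 1) + g (N - m) j\<close>.

  The hypotheses on \<open>\<mu>\<close> say that a finite letter is followed by \<open>l - 1\<close> infinite letters and
  then by a strictly larger letter. Words of length \<open>n\<close> whose first letter exceeds \<open>c\<close> are
  therefore counted by \<open>g (d n - c)\<close>: either the first letter exceeds \<open>c + 1\<close>, or it equals
  \<open>c + 1\<close> and removing the first \<open>l\<close> letters leaves a word of length \<open>n - l\<close> whose first letter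
  exceeds \<open>c + 1\<close>.

  The digraph with steps \<open>(1, 0)\<close> and \<open>(m + 1, 1)\<close> satisfies the same recurrence, and drawing it
  with straight segments is planar.

  For the zeros, the row polynomials satisfy \<open>p\<^sub>N\<^sub>+\<^sub>1 = p\<^sub>N + z p\<^sub>N\<^sub>-\<^sub>m\<close>. If \<open>Im z > 0\<close>, then
  by induction the quotients \<open>p\<^sub>j / p\<^sub>i\<close> with \<open>i \<le> j \<le> i + m\<close> lie in the sector
  \<open>0 \<le> arg w \<le> arg z\<close>: the sector is a convex cone, and \<open>w \<mapsto> z / w\<close> maps it to itself.
  Since it contains no line, the sum \<open>p\<^sub>N + z p\<^sub>N\<^sub>-\<^sub>m\<close> never vanishes.
\<close>

section \<open>Gapped binomial coefficients\<close>

text \<open>Subtraction is truncated: for \<open>N < j * m\<close> the value is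
  \<open>0 choose j\<close>, which vanishes because then \<open>j > 0\<close>.\<close>

definition gap_choose :: "nat \<Rightarrow> nat \<Rightarrow> nat \<Rightarrow> nat" where
  "gap_choose m N j = (N - j * m) choose j"

lemma gap_choose_0 [simp]: "gap_choose m N 0 = 1" "gap_choose m 0 j = (if j = 0 then 1 else 0)"
  by (auto simp: gap_choose_def)

lemma gap_choose_eq_0: "N < j \<Longrightarrow> gap_choose m N j = 0"
  by (simp add: gap_choose_def binomial_eq_0)

text \<open>Pascal's rule with upper entry \<open>N - Suc j * m\<close>, which equals
  \<open>N - m - j * m\<close>. The guard matters at \<open>j = 0\<close>, where truncation would
  contribute a spurious 1.\<close>

lemma gap_choose_Suc_Suc:
  "gap_choose m (Suc N) (Suc j) =
     gap_choose m N (Suc j) + (if m \<le> N then gap_choose m (N - m) j else 0)"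
proof (cases "Suc j * m \<le> N")
  case True
  then have "Suc N - Suc j * m = Suc (N - Suc j * m)" and "N - m - j * m = N - Suc j * m"
    and "m \<le> N"
    by auto
  then show ?thesis
    by (simp only: gap_choose_def) simp
next
  case False
  \<comment> \<open>The upper entry truncates to 0, and \<open>m \<le> N\<close> excludes
    \<open>j = 0\<close>.\<close>
  then have "(N - m - j * m) choose j = 0" if "m \<le> N"
    using that by (cases j) auto
  with False show ?thesis
    by (simp add: gap_choose_def)
qed

section \<open>Enumeration of anchor words\<close>

text \<open>Parts decrease weakly, so \<open>\<mu> ! k \<ge> d\<close> for all \<open>k < l\<close>.
  Adding at least \<open>d\<close> to a letter that is at least 1 exceeds every finite letter, which
  forces the gap to be infinite; adding \<open>\<mu> ! l = 1\<close> gives the strict inequality.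
  The condition on the end of the word becomes \<open>i + l < n\<close>.\<close>

lemma anchor_word_iff:
  assumes part: "is_partition \<mu>" and len: "length \<mu> = Suc l" and l: "1 \<le> l"
    and last: "\<mu> ! l = 1" and large: "d \<le> \<mu> ! (l - 1)"
  shows "anchor_word \<mu> d n w \<longleftrightarrow>
    length w = n \<and> set w \<subseteq> insert \<infinity> (enat ` {1..d}) \<and>
    (\<forall>i<n. w ! i \<noteq> \<infinity> \<longrightarrow>
       i + l < n \<and> (\<forall>k\<in>{1..<l}. w ! (i + k) = \<infinity>) \<and> w ! i < w ! (i + l))"
proof -
  have mu: "d \<le> \<mu> ! k" if "k < l" for k
  proof -
    have "\<mu> ! (l - 1) \<le> \<mu> ! k"
      using part that len l unfolding is_partition_def sorted_wrt_iff_nth_less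
      by (cases "k = l - 1") auto
    with large show ?thesis by linarith
  qed
  have step: "(\<forall>k\<in>{1..l}. i + k < n \<longrightarrow> w ! i + enat (\<mu> ! k) \<le> w ! (i + k)) \<longleftrightarrow>
      (\<forall>k\<in>{1..<l}. w ! (i + k) = \<infinity>) \<and> w ! i < w ! (i + l)"
    if w: "length w = n" "set w \<subseteq> insert \<infinity> (enat ` {1..d})" and i: "i + l < n" "w ! i \<noteq> \<infinity>"
    for i
  proof -
    have letter: "w ! k = \<infinity> \<or> (\<exists>b\<in>{1..d}. w ! k = enat b)" if "k < n" for k
      using w that nth_mem[of k w] by blast
    obtain a where a: "w ! i = enat a" "1 \<le> a"
      using letter[of i] i by auto
    have inf: "w ! i + enat (\<mu> ! k) \<le> w ! (i + k) \<longleftrightarrow> w ! (i + k) = \<infinity>" if "k < l" for k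
      using letter[of "i + k"] mu[OF that] a i that by auto
    have final: "w ! i + enat (\<mu> ! l) \<le> w ! (i + l) \<longleftrightarrow> w ! i < w ! (i + l)"
      using letter[of "i + l"] last a i by auto
    have "{1..l} = insert l {1..<l}"
      using l by auto
    then show ?thesis
      using i inf final by auto
  qed
  have "(w ! i \<noteq> \<infinity> \<longrightarrow>
        (\<forall>k\<in>{1..l}. i + k < n \<longrightarrow> w ! i + enat (\<mu> ! k) \<le> w ! (i + k))) \<and>
      (n \<le> i + l \<longrightarrow> w ! i = \<infinity>) \<longleftrightarrow>
      (w ! i \<noteq> \<infinity> \<longrightarrow>
        i + l < n \<and> (\<forall>k\<in>{1..<l}. w ! (i + k) = \<infinity>) \<and> w ! i < w ! (i + l))"
    if w: "length w = n" "set w \<subseteq> insert \<infinity> (enat ` {1..d})" and i: "i < n" for i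
  \<comment> \<open>In the other case both sides amount to
    \<open>w ! i = \<infinity>\<close>.\<close>
  proof (cases "i + l < n \<and> w ! i \<noteq> \<infinity>")
    case True
    then show ?thesis
      using step[OF w, of i] by simp
  qed auto
  then have "length w = n \<Longrightarrow> set w \<subseteq> insert \<infinity> (enat ` {1..d}) \<Longrightarrow>
      (\<forall>i<n. w ! i \<noteq> \<infinity> \<longrightarrow>
        (\<forall>k\<in>{1..l}. i + k < n \<longrightarrow> w ! i + enat (\<mu> ! k) \<le> w ! (i + k))) \<and>
      (\<forall>i<n. n \<le> i + l \<longrightarrow> w ! i = \<infinity>) \<longleftrightarrow>
      (\<forall>i<n. w ! i \<noteq> \<infinity> \<longrightarrow>
        i + l < n \<and> (\<forall>k\<in>{1..<l}. w ! (i + k) = \<infinity>) \<and> w ! i < w ! (i + l))"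
    by blast
  moreover have "length \<mu> - 1 = l"
    using len by simp
  ultimately show ?thesis
    unfolding anchor_word_def Let_def by (intro conj_cong refl) simp
qed

section \<open>Counting anchor words by their first letter\<close>

context
  fixes \<mu> :: "nat list" and l d :: nat
  assumes part: "is_partition \<mu>" and len: "length \<mu> = Suc l" and l: "1 \<le> l"
    and last: "\<mu> ! l = 1" and large: "d \<le> \<mu> ! (l - 1)"
begin

lemmas anchor_iff = anchor_word_iff[OF part len l last large]

text \<open>Constraints only look ahead, so a new first letter leaves those inside \<open>w\<close>
  intact and adds its own. Position \<open>l\<close> of the long word is position
  \<open>l - 1\<close> of \<open>w\<close>.\<close>

lemma anchor_word_Cons:
  "anchor_word \<mu> d (Suc n) (a # w) \<longleftrightarrow>
     anchor_word \<mu> d n w \<and>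
     (a = \<infinity> \<or> a \<in> enat ` {1..d} \<and> l \<le> n \<and> (\<forall>k<l - 1. w ! k = \<infinity>) \<and> a < w ! (l - 1))"
proof -
  have gap: "(\<forall>k\<in>{1..<l}. (a # w) ! k = \<infinity>) \<longleftrightarrow> (\<forall>k<l - 1. w ! k = \<infinity>)" (is "?L \<longleftrightarrow> ?R")
  proof
    assume ?L
    then show ?R
      by (auto dest!: bspec[of _ _ "Suc _"])
  qed auto
  have next_letter: "(a # w) ! l = w ! (l - 1)"
    using l by simp
  show ?thesis
    unfolding anchor_iff All_less_Suc2
    unfolding plus_nat.add_0 add_Suc nth_Cons_0 nth_Cons_Suc gap next_letter
      Suc_less_eq less_Suc_eq_le Suc_le_eq list.set(2) insert_subset length_Cons nat.inject
    by blast
qed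

lemma length_anchor_word: "anchor_word \<mu> d n w \<Longrightarrow> length w = n"
  by (simp add: anchor_iff)

lemma anchor_word_replicate_infinity:
  "anchor_word \<mu> d (k + n) (replicate k \<infinity> @ w) \<longleftrightarrow> anchor_word \<mu> d n w"
  by (induction k) (auto simp: anchor_word_Cons)

text \<open>Letting \<open>c\<close> run from 0 to \<open>d\<close> cuts the passage from one length
  to the next into \<open>d\<close> unit steps, the scale of the Pascal recurrence. The empty word
  meets every bound.\<close>

definition high_words :: "nat \<Rightarrow> nat \<Rightarrow> nat \<Rightarrow> enat list set" where
  "high_words n c j =
     {w. anchor_word \<mu> d n w \<and> bigtiles w = j \<and> (w \<noteq> [] \<longrightarrow> enat c < w ! 0)}"

lemma finite_high_words: "finite (high_words n c j)"
  by (rule finite_subset[OF _ finite_anchor_words]) (auto simp: high_words_def)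

lemma anchor_word_nth_0_pos: "anchor_word \<mu> d n w \<Longrightarrow> w \<noteq> [] \<Longrightarrow> 0 < w ! 0"
  by (cases w) (auto simp: anchor_iff zero_enat_def)

lemma high_words_0: "high_words 0 c j = (if j = 0 then {[]} else {})"
  by (auto simp: high_words_def anchor_iff bigtiles_def)

text \<open>A first letter above \<open>d\<close> is infinite and imposes nothing on the rest;
  letters are at least 1, so the bound 0 is vacuous. This matches
  \<open>d * Suc n - d = d * n - 0\<close>.\<close>

lemma high_words_Suc_d: "high_words (Suc n) d j = Cons \<infinity> ` high_words n 0 j"
proof (intro set_eqI)
  fix w
  show "w \<in> high_words (Suc n) d j \<longleftrightarrow> w \<in> Cons \<infinity> ` high_words n 0 j"
  proof (cases w)
    case Nil
    then show ?thesis
      by (auto simp: high_words_def dest: length_anchor_word)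
  next
    case (Cons a u)
    then show ?thesis
      using anchor_word_nth_0_pos[of n u]
      by (auto simp: high_words_def anchor_word_Cons bigtiles_def zero_enat_def)
  qed
qed

lemma high_words_split:
  assumes "c < d"
  shows "high_words (Suc n) c j = high_words (Suc n) (Suc c) j \<union>
    (if l \<le> n \<and> 0 < j
     then (\<lambda>u. enat (Suc c) # replicate (l - 1) \<infinity> @ u) ` high_words (Suc n - l) (Suc c) (j - 1)
     else {})"
proof (intro set_eqI)
  fix w
  let ?f = "\<lambda>u. enat (Suc c) # replicate (l - 1) \<infinity> @ u"
  let ?low = "if l \<le> n \<and> 0 < j then ?f ` high_words (Suc n - l) (Suc c) (j - 1) else {}"
  show "w \<in> high_words (Suc n) c j \<longleftrightarrow> w \<in> high_words (Suc n) (Suc c) j \<union> ?low"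
  proof (cases w)
    case Nil
    then show ?thesis
      by (auto simp: high_words_def dest: length_anchor_word)
  next
    case (Cons a v)
    have first: "enat c < a \<longleftrightarrow> a = enat (Suc c) \<or> enat (Suc c) < a"
      by (cases a) auto
    have "w \<in> high_words (Suc n) c j \<longleftrightarrow> w \<in> ?low" if a: "a = enat (Suc c)"
    proof
      assume "w \<in> high_words (Suc n) c j"
      then have v: "anchor_word \<mu> d n v" "l \<le> n" "\<forall>k<l - 1. v ! k = \<infinity>"
        "enat (Suc c) < v ! (l - 1)" and j: "j = Suc (bigtiles v)"
        by (auto simp: high_words_def Cons a anchor_word_Cons bigtiles_def)
      have "length v = n"
        using v(1) by (rule length_anchor_word)
      define u where "u = drop (l - 1) v"
      have "take (l - 1) v = replicate (l - 1) \<infinity>"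
        using v(2,3) \<open>length v = n\<close> by (intro nth_equalityI) auto
      then have split: "v = replicate (l - 1) \<infinity> @ u"
        unfolding u_def by (metis append_take_drop_id)
      have "n = (l - 1) + (Suc n - l)"
        using l v(2) by simp
      then have "anchor_word \<mu> d (Suc n - l) u"
        using v(1) anchor_word_replicate_infinity[of "l - 1" "Suc n - l" u] split by simp
      moreover have "enat (Suc c) < u ! 0"
        using v(4) by (simp add: split nth_append)
      moreover have "bigtiles u = j - 1"
        by (simp add: j split bigtiles_def)
      ultimately show "w \<in> ?low"
        using v(2) j by (auto simp: Cons a split high_words_def)
    next
      assume "w \<in> ?low"
      then obtain u where u: "u \<in> high_words (Suc n - l) (Suc c) (j - 1)" "l \<le> n" "0 < j"
        and v: "v = replicate (l - 1) \<infinity> @ u"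
        by (auto simp: Cons split: if_splits)
      have "length u = Suc n - l"
        using u(1) by (auto simp: high_words_def dest: length_anchor_word)
      \<comment> \<open>The bound in \<open>high_words\<close> therefore concerns an actual letter
        of \<open>u\<close>.\<close>
      then have "u \<noteq> []"
        using u(2) by auto
      have "n = (l - 1) + (Suc n - l)"
        using l u(2) by simp
      then have "anchor_word \<mu> d n v"
        using u(1) anchor_word_replicate_infinity[of "l - 1" "Suc n - l" u]
        by (simp add: v high_words_def)
      moreover have "bigtiles v = j - 1"
        using u(1) by (simp add: v bigtiles_def high_words_def)
      moreover have "enat (Suc c) < v ! (l - 1)"
        using u(1) \<open>u \<noteq> []\<close> by (simp add: v nth_append high_words_def)
      ultimately show "w \<in> high_words (Suc n) c j"
        using u(2,3) assms
        by (auto simp: Cons a high_words_def anchor_word_Cons v nth_append bigtiles_def)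
    qed
    then show ?thesis
      using first by (auto simp: Cons high_words_def split: if_splits)
  qed
qed

text \<open>The induction on \<open>n\<close> is strong because removing a finite first letter with
  its gap shortens the word by \<open>l\<close>. The inner induction runs \<open>c\<close> down from
  \<open>d\<close>, where \<open>high_words_Suc_d\<close> leads to the previous length.\<close>

lemma card_high_words: "c \<le> d \<Longrightarrow> card (high_words n c j) = gap_choose (d * l) (d * n - c) j"
proof (induction n arbitrary: c j rule: less_induct)
  case (less n)
  show ?case
  proof (cases n)
    case 0
    then show ?thesis
      by (simp add: high_words_0)
  next
    case (Suc m)
    have "card (high_words (Suc m) c j) = gap_choose (d * l) (d * Suc m - c) j"
      using less.prems
    proof (induction rule: inc_induct)
      case base
      show ?case
        using less.IH[of m 0 j] Suc by (simp add: high_words_Suc_d card_image)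
    next
      case (step c)
      let ?f = "\<lambda>u. enat (Suc c) # replicate (l - 1) \<infinity> @ u"
      define low where
        "low = (if l \<le> m \<and> 0 < j then ?f ` high_words (Suc m - l) (Suc c) (j - 1) else {})"
      define N where "N = d * Suc m - Suc c"
      have N: "d * Suc m - c = Suc N"
        using step.hyps by (simp add: N_def)
      \<comment> \<open>\<open>N\<close> is \<open>d * m\<close> plus a remainder below
        \<open>d\<close>, so the guard on words is exactly the guard in
        \<open>gap_choose_Suc_Suc\<close>.\<close>
      have range: "d * l \<le> N \<longleftrightarrow> l \<le> m"
      proof
        assume "l \<le> m"
        then have "d * l \<le> d * m" by (rule mult_le_mono2)
        moreover have "N = d * m + (d - Suc c)"
          using step.hyps by (simp add: N_def)
        ultimately show "d * l \<le> N" by linarith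
      next
        assume "d * l \<le> N"
        then have "d * l < d * Suc m" using N by linarith
        then have "l < Suc m" by (simp only: mult_less_cancel1)
        then show "l \<le> m" by simp
      qed
      have "inj_on ?f S" for S
        by (auto simp: inj_on_def)
      moreover have "d * (Suc m - l) - Suc c = N - d * l"
        by (simp only: N_def diff_mult_distrib2 diff_commute)
      ultimately have low: "card low =
          (if l \<le> m \<and> 0 < j then gap_choose (d * l) (N - d * l) (j - 1) else 0)"
        using less.IH[of "Suc m - l" "Suc c" "j - 1"] Suc step.hyps l
        by (auto simp: low_def card_image)
      have "high_words (Suc m) (Suc c) j \<inter> low = {}"
        by (auto simp: low_def high_words_def split: if_splits)
      moreover have "finite low"
        by (simp add: low_def finite_high_words)
      moreover have "high_words (Suc m) c j = high_words (Suc m) (Suc c) j \<union> low"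
        unfolding low_def by (rule high_words_split) (use step.hyps in simp)
      ultimately have "card (high_words (Suc m) c j) = gap_choose (d * l) N j + card low"
        using step.IH by (simp add: card_Un_disjoint finite_high_words N_def)
      then show ?case
        unfolding N low using range by (cases j) (auto simp: gap_choose_Suc_Suc)
    qed
    with Suc show ?thesis by simp
  qed
qed

lemma coeff_anchor_poly: "coeff (anchor_poly \<mu> d n) j = gap_choose (d * l) (d * n) j"
proof -
  have "coeff (anchor_poly \<mu> d n) j =
      (\<Sum>w | anchor_word \<mu> d n w. if bigtiles w = j then 1 else 0)"
    by (simp add: anchor_poly_def coeff_sum)
  also have "\<dots> = card {w. anchor_word \<mu> d n w \<and> bigtiles w = j}"
    by (simp add: sum.If_cases finite_anchor_words Collect_conj_eq)
  also have "{w. anchor_word \<mu> d n w \<and> bigtiles w = j} = high_words n 0 j"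
    using anchor_word_nth_0_pos by (auto simp: high_words_def zero_enat_def)
  finally show ?thesis
    by (simp add: card_high_words)
qed

end

section \<open>Lattice paths\<close>

text \<open>A path from the origin to \<open>(N, j)\<close> has \<open>j\<close> diagonal and
  \<open>N - j * (m + 1)\<close> horizontal steps, hence \<open>N - j * m\<close> in all; choosing
  the diagonal ones gives \<open>gap_choose m N j\<close>.\<close>

definition step_digraph :: "nat \<Rightarrow> lattice_digraph" where
  "step_digraph m = \<lparr>pverts = UNIV,
     parcs = {((a, b), (Suc a, b)) | a b. True} \<union> {((a, b), (a + Suc m, Suc b)) | a b. True}\<rparr>"

lemma pverts_step_digraph [simp]: "pverts (step_digraph m) = UNIV"
  by (simp add: step_digraph_def)

lemma mem_parcs_step_digraph:
  "((a, b), v) \<in> parcs (step_digraph m) \<longleftrightarrow> v = (Suc a, b) \<or> v = (a + Suc m, Suc b)"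
  by (auto simp: step_digraph_def)

lemma out_arcs_step_digraph:
  "out_arcs (with_proj (step_digraph m)) (a, b) =
     {((a, b), (Suc a, b)), ((a, b), (a + Suc m, Suc b))}"
  by (auto simp: out_arcs_def step_digraph_def)

lemma locally_finite_step_digraph: "locally_finite_digraph (step_digraph m)"
proof -
  have "finite (in_arcs (with_proj (step_digraph m)) (a, b))" for a b
    \<comment> \<open>No step decreases a coordinate, so the tails lie in the rectangle below the
      head.\<close>
    by (rule finite_subset[of _ "({..a} \<times> {..b}) \<times> {(a, b)}"])
       (auto simp: in_arcs_def step_digraph_def)
  then show ?thesis
    by (auto simp: locally_finite_digraph_def out_arcs_step_digraph)
qed

lemma weakly_y_invariant_step_digraph: "weakly_y_invariant (step_digraph m) (\<lambda>_. 1)"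
  by (simp add: weakly_y_invariant_def out_steps_def out_arcs_step_digraph)

lemma directed_paths_step_digraph:
  "directed_paths (step_digraph m) (a, b) v =
     (if v = (a, b) then {[]} else {}) \<union>
     Cons ((a, b), (Suc a, b)) ` directed_paths (step_digraph m) (Suc a, b) v \<union>
     Cons ((a, b), (a + Suc m, Suc b)) ` directed_paths (step_digraph m) (a + Suc m, Suc b) v"
  (is "?L = ?R")
proof (intro set_eqI)
  show "p \<in> ?L \<longleftrightarrow> p \<in> ?R" for p
    by (cases p) (auto simp: directed_paths_def pre_digraph.awalk_def
      cas_with_proj_eq mem_parcs_step_digraph image_iff)
qed

text \<open>Every arc strictly increases the first coordinate.\<close>

lemma directed_paths_step_digraph_empty:
  assumes "N < a"
  shows "directed_paths (step_digraph m) (a, b) (N, j) = {}"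
proof -
  have "a \<le> N" if "pre_digraph.awalk (with_proj (step_digraph m)) (a, b) p (N, j)" for p
    using that
  proof (induction p arbitrary: a b)
    case Nil
    then show ?case by (simp add: pre_digraph.awalk_def cas_with_proj_eq)
  next
    case (Cons e p)
    then show ?case
      by (cases e) (force simp: pre_digraph.awalk_def cas_with_proj_eq mem_parcs_step_digraph)
  qed
  with assms show ?thesis
    by (force simp: directed_paths_def)
qed

text \<open>Strong induction on the horizontal distance \<open>A\<close>, since a diagonal arc
  lowers it by \<open>m + 1\<close>. Splitting by the first arc reproduces
  \<open>gap_choose_Suc_Suc\<close>; a diagonal arc that overshoots column \<open>N\<close> is a
  failed guard.\<close>

lemma card_directed_paths_step_digraph:
  assumes "a + A = N"
  shows "finite (directed_paths (step_digraph m) (a, b) (N, j)) \<and>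
    card (directed_paths (step_digraph m) (a, b) (N, j)) =
      (if b \<le> j then gap_choose m A (j - b) else 0)"
  using assms
proof (induction A arbitrary: a b rule: less_induct)
  case (less A)
  let ?W = "\<lambda>a b. directed_paths (step_digraph m) (a, b) (N, j)"
  have inj: "inj_on (Cons e) S" for e :: "(nat \<times> nat) \<times> (nat \<times> nat)" and S
    by (auto simp: inj_on_def)
  show ?case
  proof (cases A)
    case 0
    then have "?W (Suc a) b = {}" "?W (a + Suc m) (Suc b) = {}"
      using less.prems by (auto intro!: directed_paths_step_digraph_empty)
    with 0 less.prems show ?thesis
      by (subst (1 2) directed_paths_step_digraph) auto
  next
    case (Suc B)
    have right: "finite (?W (Suc a) b)"
      "card (?W (Suc a) b) = (if b \<le> j then gap_choose m B (j - b) else 0)"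
      using less.IH[of B "Suc a" b] less.prems Suc by auto
    have diag: "finite (?W (a + Suc m) (Suc b)) \<and> card (?W (a + Suc m) (Suc b)) =
        (if m \<le> B \<and> Suc b \<le> j then gap_choose m (B - m) (j - Suc b) else 0)"
    proof (cases "m \<le> B")
      case True
      then show ?thesis
        using less.IH[of "B - m" "a + Suc m" "Suc b"] less.prems Suc by auto
    next
      case False
      then show ?thesis
        using less.prems Suc by (simp add: directed_paths_step_digraph_empty)
    qed
    have W: "?W a b = Cons ((a, b), (Suc a, b)) ` ?W (Suc a) b \<union>
        Cons ((a, b), (a + Suc m, Suc b)) ` ?W (a + Suc m) (Suc b)"
      using less.prems Suc by (subst directed_paths_step_digraph) auto
    have "card (?W a b) = card (?W (Suc a) b) + card (?W (a + Suc m) (Suc b))"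
      unfolding W using right diag
      by (subst card_Un_disjoint) (auto simp: card_image[OF inj])
    moreover have "finite (?W a b)"
      unfolding W using right diag by auto
    moreover have "j - b = Suc (j - Suc b)" if "Suc b \<le> j"
      using that by simp
    ultimately show ?thesis
      using right diag Suc
      by (cases "Suc b \<le> j") (auto simp: gap_choose_Suc_Suc not_less_eq_eq le_Suc_eq)
  qed
qed

lemma finite_path_sets_step_digraph: "finite_path_sets (step_digraph m)"
  unfolding finite_path_sets_def
proof (intro ballI)
  fix u v :: "nat \<times> nat"
  obtain a b N j where [simp]: "u = (a, b)" "v = (N, j)"
    by (cases u, cases v)
  show "finite (directed_paths (step_digraph m) u v)"
    using card_directed_paths_step_digraph[of a "N - a" N]
    by (cases "a \<le> N") (auto simp: directed_paths_step_digraph_empty)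
qed

lemma weighted_paths_step_digraph:
  "weighted_paths (step_digraph m) (\<lambda>_. 1) N j = of_nat (gap_choose m N j)"
proof -
  have "prod_list (map (\<lambda>_. 1) p) = (1 :: real)" for p :: "((nat \<times> nat) \<times> (nat \<times> nat)) list"
    by (induction p) auto
  then show ?thesis
    using card_directed_paths_step_digraph[of 0 N N m 0 j] by (simp add: weighted_paths_def)
qed

section \<open>Planarity of the straight-line drawing\<close>

lemma lattice_point_eq_iff [simp]: "lattice_point u = lattice_point v \<longleftrightarrow> u = v"
  by (auto simp: lattice_point_def prod_eq_iff)

lemma nat_in_unit_interval: "real a \<le> real k \<Longrightarrow> real k \<le> real a + 1 \<Longrightarrow> k = a \<or> k = Suc a"
  by linarith

abbreviation arc_segment :: "(nat \<times> nat) \<times> (nat \<times> nat) \<Rightarrow> (real \<times> real) set" where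
  "arc_segment e \<equiv> closed_segment (lattice_point (fst e)) (lattice_point (snd e))"

lemma arc_segment_right:
  "arc_segment ((a, b), (Suc a, b)) = {(real a + t, real b) | t. 0 \<le> t \<and> t \<le> 1}"
  by (auto simp: closed_segment_def lattice_point_def algebra_simps)

lemma arc_segment_diagonal:
  "arc_segment ((a, b), (a + Suc m, Suc b)) =
     {(real a + t * (real m + 1), real b + t) | t. 0 \<le> t \<and> t \<le> 1}"
  by (auto simp: closed_segment_def lattice_point_def algebra_simps)

text \<open>A horizontal arc has length 1, and a diagonal arc, however long, rises by exactly 1; so
  integrality of one coordinate forces an endpoint.\<close>

lemma arc_segment_lattice_points:
  assumes "e \<in> parcs (step_digraph m)"
  shows "arc_segment e \<inter> range lattice_point \<subseteq> {lattice_point (fst e), lattice_point (snd e)}"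
proof
  fix x assume "x \<in> arc_segment e \<inter> range lattice_point"
  then obtain k i where x: "x \<in> arc_segment e" "x = (real k, real i)"
    by (auto simp: lattice_point_def simp del: fst_conv snd_conv)
  consider a b where "e = ((a, b), (Suc a, b))" | a b where "e = ((a, b), (a + Suc m, Suc b))"
    using assms by (auto simp: step_digraph_def)
  then show "x \<in> {lattice_point (fst e), lattice_point (snd e)}"
  proof cases
    case 1
    then obtain t where t: "real k = real a + t" "0 \<le> t" "t \<le> 1" "i = b"
      using x unfolding arc_segment_right 1 by auto
    then have "k = a \<or> k = Suc a"
      by (intro nat_in_unit_interval) auto
    then show ?thesis
      using 1 x t by (auto simp: lattice_point_def)
  next
    case 2
    then obtain t where t: "real k = real a + t * (real m + 1)" "real i = real b + t" "0 \<le> t" "t \<le> 1"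
      using x unfolding arc_segment_diagonal 2 by auto
    then have "i = b \<or> i = Suc b"
      by (intro nat_in_unit_interval) auto
    then have "t = 0 \<or> t = 1"
      using t by auto
    then show ?thesis
      using 2 x t by (auto simp: lattice_point_def)
  qed
qed

text \<open>Horizontal arcs sit at integral heights, where a diagonal arc has only its endpoints.
  Arcs of the same kind are parallel translates by integer vectors and can only touch at
  ends.\<close>

lemma arc_segments_meet:
  assumes e: "e \<in> parcs (step_digraph m)" "e' \<in> parcs (step_digraph m)" "e \<noteq> e'"
    and x: "x \<in> arc_segment e" "x \<in> arc_segment e'"
  shows "x \<in> range lattice_point"
proof -
  have lattice: "(real k, real i) \<in> range lattice_point" for k i
    by (rule range_eqI[of _ _ "(k, i)"]) (simp add: lattice_point_def)
  have right_diag: "x \<in> range lattice_point"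
    if right: "x \<in> arc_segment ((a, b), (Suc a, b))"
      and diag: "x \<in> arc_segment ((a', b'), (a' + Suc m, Suc b'))" for a b a' b'
  proof -
    obtain s where s: "x = (real a + s, real b)"
      using right unfolding arc_segment_right by auto
    obtain t where t: "x = (real a' + t * (real m + 1), real b' + t)" "0 \<le> t" "t \<le> 1"
      using diag unfolding arc_segment_diagonal by auto
    from s t have "real b = real b' + t"
      by simp
    with t have "b = b' \<or> b = Suc b'"
      by (intro nat_in_unit_interval) auto
    then have "t = 0 \<or> t = 1"
      using \<open>real b = real b' + t\<close> by auto
    then show ?thesis
      using t lattice[of a' b'] lattice[of "a' + m + 1" "b' + 1"] by (auto simp: algebra_simps)
  qed
  have right_right: "x \<in> range lattice_point"
    if meet: "x \<in> arc_segment ((a, b), (Suc a, b))" "x \<in> arc_segment ((a', b'), (Suc a', b'))"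
      and "a < a'"
    for a b a' b'
  proof -
    obtain t where "x = (real a' + t, real b)" "0 \<le> t" "real a' + t \<le> real a + 1"
      using meet unfolding arc_segment_right by auto
    moreover from this have "t = 0"
      using \<open>a < a'\<close> by linarith
    ultimately show ?thesis
      using lattice by simp
  qed
  have diag_diag: "x \<in> range lattice_point"
    if meet: "x \<in> arc_segment ((a, b), (a + Suc m, Suc b))"
        "x \<in> arc_segment ((a', b'), (a' + Suc m, Suc b'))"
      and distinct: "(a, b) \<noteq> (a', b')" for a b a' b'
  proof -
    obtain t t' where t: "x = (real a + t * (real m + 1), real b + t)" "0 \<le> t" "t \<le> 1"
      and t': "x = (real a' + t' * (real m + 1), real b' + t')" "0 \<le> t'" "t' \<le> 1"
      using meet unfolding arc_segment_diagonal by blast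
    \<comment> \<open>Equal heights would give \<open>t = t'\<close> and then
      \<open>a = a'\<close>.\<close>
    have "b \<noteq> b'"
      using t t' distinct by auto
    \<comment> \<open>\<open>t - t'\<close> is a nonzero integer in [-1, 1].\<close>
    then have "t = 0 \<or> t = 1"
      using t t' by (cases "b < b'") auto
    then show ?thesis
      using t lattice[of a b] lattice[of "a + m + 1" "b + 1"] by (auto simp: algebra_simps)
  qed
  consider (rr) a b a' b' where "e = ((a, b), (Suc a, b))" "e' = ((a', b'), (Suc a', b'))"
    | (rd) a b a' b' where "e = ((a, b), (Suc a, b))" "e' = ((a', b'), (a' + Suc m, Suc b'))"
    | (dr) a b a' b' where "e = ((a, b), (a + Suc m, Suc b))" "e' = ((a', b'), (Suc a', b'))"
    | (dd) a b a' b' where "e = ((a, b), (a + Suc m, Suc b))"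
        "e' = ((a', b'), (a' + Suc m, Suc b'))"
    using e(1,2) unfolding step_digraph_def by fastforce
  then show ?thesis
  proof cases
    case rr
    then have "b = b'"
      using x by (auto simp: arc_segment_right simp del: fst_conv snd_conv)
    with rr e have "a < a' \<or> a' < a"
      by auto
    then show ?thesis
      using right_right rr x by metis
  next
    case rd
    then show ?thesis using right_diag x by metis
  next
    case dr
    then show ?thesis using right_diag x by metis
  next
    case dd
    then have "(a, b) \<noteq> (a', b')" using e by auto
    then show ?thesis using diag_diag dd x by metis
  qed
qed

text \<open>A common point of two arcs is a lattice point, and a lattice point on an arc is one of
  its endpoints.\<close>

lemma planar_step_digraph: "planar_digraph (step_digraph m)"
  unfolding planar_digraph_def
proof (intro exI[of _ "\<lambda>e. linepath (lattice_point (fst e)) (lattice_point (snd e))"]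
    conjI ballI impI)
  fix e assume e: "e \<in> parcs (step_digraph m)"
  then have "fst e \<noteq> snd e"
    by (auto simp: step_digraph_def)
  then show "simple_path (linepath (lattice_point (fst e)) (lattice_point (snd e)))"
    by (simp add: simple_path_linepath)
  show "path_image (linepath (lattice_point (fst e)) (lattice_point (snd e))) \<inter>
      lattice_point ` pverts (step_digraph m) \<subseteq> {lattice_point (fst e), lattice_point (snd e)}"
    using arc_segment_lattice_points[OF e] by simp
  fix e' assume e': "e' \<in> parcs (step_digraph m)" "e \<noteq> e'"
  show "path_image (linepath (lattice_point (fst e)) (lattice_point (snd e))) \<inter>
      path_image (linepath (lattice_point (fst e')) (lattice_point (snd e')))
      \<subseteq> lattice_point ` ({fst e, snd e} \<inter> {fst e', snd e'})"
  proof
    fix x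
    assume "x \<in> path_image (linepath (lattice_point (fst e)) (lattice_point (snd e))) \<inter>
      path_image (linepath (lattice_point (fst e')) (lattice_point (snd e')))"
    then have x: "x \<in> arc_segment e" "x \<in> arc_segment e'"
      by auto
    obtain v where v: "x = lattice_point v"
      using arc_segments_meet[OF e e' x] by (rule rangeE)
    have "v \<in> {fst e, snd e}" "v \<in> {fst e', snd e'}"
      using arc_segment_lattice_points[OF e] arc_segment_lattice_points[OF e'(1)] x
      unfolding v by auto
    then show "x \<in> lattice_point ` ({fst e, snd e} \<inter> {fst e', snd e'})"
      unfolding v by blast
  qed
qed auto

section \<open>Zeros\<close>

text \<open>Polymorphic, so that the real polynomial and its complex image are the same
  expression.\<close>

definition gap_poly :: "nat \<Rightarrow> nat \<Rightarrow> 'a::comm_semiring_1 poly" where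
  "gap_poly m N = (\<Sum>j\<le>N. monom (of_nat (gap_choose m N j)) j)"

lemma coeff_gap_poly: "coeff (gap_poly m N) j = of_nat (gap_choose m N j)"
  by (auto simp: gap_poly_def coeff_sum gap_choose_eq_0)

lemma gap_poly_0: "gap_poly m 0 = 1"
  by (simp add: gap_poly_def)

lemma gap_poly_Suc:
  "gap_poly m (Suc N) = gap_poly m N + (if m \<le> N then pCons 0 (gap_poly m (N - m)) else 0)"
proof (rule poly_eqI)
  show "coeff (gap_poly m (Suc N)) j =
      coeff (gap_poly m N + (if m \<le> N then pCons 0 (gap_poly m (N - m)) else 0)) j" for j
    by (cases j) (auto simp: coeff_gap_poly gap_choose_Suc_Suc)
qed

lemma map_poly_of_real_gap_poly: "map_poly complex_of_real (gap_poly m N) = gap_poly m N"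
  by (rule poly_eqI) (simp add: coeff_map_poly coeff_gap_poly)

text \<open>For \<open>a \<noteq> 0\<close> and \<open>Im z > 0\<close> this says \<open>0 \<le> arg (b / a) \<le> arg z\<close>, a convex condition on \<open>b\<close>.\<close>

definition in_sector :: "complex \<Rightarrow> complex \<Rightarrow> complex \<Rightarrow> bool" where
  "in_sector z a b \<longleftrightarrow> 0 \<le> Im (b * cnj a) \<and> 0 \<le> Im (z * a * cnj b)"

lemma in_sector_refl: "0 \<le> Im z \<Longrightarrow> in_sector z a a"
proof -
  assume "0 \<le> Im z"
  moreover have "Im (z * a * cnj a) = Im z * (cmod a)\<^sup>2"
    by (simp only: cmod_power2) (simp add: power2_eq_square algebra_simps)
  ultimately show ?thesis
    by (simp add: in_sector_def del: times_complex.simps)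
qed

lemma in_sector_add: "in_sector z a b \<Longrightarrow> in_sector z a b' \<Longrightarrow> in_sector z a (b + b')"
  by (simp add: in_sector_def algebra_simps)

text \<open>Passing from w = a / b to z / w swaps the two inequalities, up to the factor
  \<open>(cmod z)\<^sup>2\<close>.\<close>

lemma in_sector_mult: "in_sector z b a \<Longrightarrow> in_sector z a (z * b)"
proof -
  assume ba: "in_sector z b a"
  have "Im (z * a * cnj (z * b)) = (cmod z)\<^sup>2 * Im (a * cnj b)"
    by (simp only: cmod_power2) (simp add: power2_eq_square algebra_simps)
  with ba show ?thesis
    by (simp add: in_sector_def)
qed

text \<open>If \<open>a = - (z * b)\<close>, then \<open>a * cnj b\<close> has imaginary part
  \<open>- Im z * (cmod b)\<^sup>2\<close>, which is negative unless \<open>b = 0\<close>, and then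
  \<open>a = 0\<close>.\<close>

lemma in_sector_sum_nonzero:
  assumes "0 < Im z" "in_sector z b a" "a \<noteq> 0"
  shows "a + z * b \<noteq> 0"
proof
  assume "a + z * b = 0"
  then have a: "a = - (z * b)"
    by (simp add: eq_neg_iff_add_eq_0)
  have "a * cnj b = - (z * of_real ((cmod b)\<^sup>2))"
    unfolding a by (simp only: mult.assoc complex_norm_square) (simp add: mult_ac)
  then have "Im z * (cmod b)\<^sup>2 \<le> 0"
    using assms(2) by (simp add: in_sector_def)
  then have "b = 0"
    using assms(1) by (auto simp: mult_le_0_iff)
  with a assms(3) show False
    by simp
qed

lemma gap_poly_in_sector:
  assumes "0 < Im z" "i \<le> j" "j \<le> i + m"
  shows "in_sector z (poly (gap_poly m i) z) (poly (gap_poly m j) z)"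
  using assms(2,3)
proof (induction j arbitrary: i rule: less_induct)
  case (less j)
  have refl: "in_sector z a a" for a
    using assms(1) by (simp add: in_sector_refl)
  show ?case
  proof (cases "i = j")
    case False
    then obtain N where j: "j = Suc N" "i \<le> N"
      using less.prems by (cases j) auto
    have 1: "in_sector z (poly (gap_poly m i) z) (poly (gap_poly m N) z)"
      using less j by auto
    \<comment> \<open>Now \<open>i\<close> is the larger index, still below \<open>j\<close>; the
      window \<open>j \<le> i + m\<close> yields \<open>N - m \<le> i\<close>. By
      \<open>in_sector_mult\<close> this places the new summand in the sector of the polynomial at
      \<open>i\<close>.\<close>
    have 2: "in_sector z (poly (gap_poly m (N - m)) z) (poly (gap_poly m i) z)" if "m \<le> N"
      using less j that by auto
    show ?thesis
      using 1 2 unfolding j gap_poly_Suc by (auto intro: in_sector_add in_sector_mult)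
  qed (simp add: refl)
qed

text \<open>\<open>in_sector\<close> holds trivially when an argument is 0, so nonvanishing is a
  separate induction.\<close>

lemma gap_poly_nonzero_upper:
  assumes "0 < Im z"
  shows "poly (gap_poly m N) z \<noteq> 0"
proof (induction N)
  case (Suc N)
  have "in_sector z (poly (gap_poly m (N - m)) z) (poly (gap_poly m N) z)" if "m \<le> N"
    using that by (intro gap_poly_in_sector[OF assms]) auto
  then show ?case
    using in_sector_sum_nonzero[OF assms] Suc by (auto simp: gap_poly_Suc)
qed (simp add: gap_poly_0)

text \<open>Real coefficients carry the upper half-plane result to the lower one, so zeros are real;
  the recurrence makes the values at positive reals positive.\<close>

lemma only_real_nonpos_zeros_gap_poly: "only_real_nonpos_zeros (gap_poly m N)"
  unfolding only_real_nonpos_zeros_def map_poly_of_real_gap_poly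
proof (intro allI impI)
  fix z :: complex
  assume z: "poly (gap_poly m N) z = 0"
  have "poly (gap_poly m N) (cnj z) = cnj (poly (gap_poly m N) z)"
    by (simp add: gap_poly_def poly_sum poly_monom)
  with z have "poly (gap_poly m N) (cnj z) = 0"
    by simp
  with z have "\<not> 0 < Im z" "\<not> 0 < Im (cnj z)"
    using gap_poly_nonzero_upper by blast+
  then have real: "z = of_real (Re z)"
    by (simp add: complex_eq_iff)
  have "poly (gap_poly m N) z = of_real (poly (gap_poly m N) (Re z))"
    by (subst real) (simp add: gap_poly_def poly_sum poly_monom)
  with z have "poly (gap_poly m N) (Re z) = 0"
    by simp
  moreover have "0 < poly (gap_poly m N) x" if "0 < x" for x :: real
  proof (induction N rule: less_induct)
    case (less N)
    show ?case
    proof (cases N)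
      case (Suc N')
      then have "0 < poly (gap_poly m N') x" "0 < poly (gap_poly m (N' - m)) x"
        using less.IH by auto
      with Suc that show ?thesis
        by (simp add: gap_poly_Suc add_pos_pos)
    qed (simp add: gap_poly_0)
  qed
  ultimately have "Re z \<le> 0"
    by (metis less_irrefl not_le)
  with real show "z \<in> \<real> \<and> Re z \<le> 0"
    by (metis Reals_of_real)
qed

theorem theorem4p26:
  fixes \<mu> :: "nat list" and l d :: nat
  assumes "is_partition \<mu>" and "length \<mu> = Suc l" and "1 \<le> l"
    and "1 \<le> d" and "d \<le> \<mu> ! 0"
    and "\<mu> ! l = 1" and "d \<le> \<mu> ! (l - 1)"
  shows "(\<forall>n. anchor_poly \<mu> d n =
              (\<Sum>j | j * l \<le> n. monom (of_nat ((d * (n - j * l)) choose j)) j)) \<and>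
         brenti_sequence (\<lambda>n. anchor_poly \<mu> d n) \<and>
         (\<forall>n. only_real_nonpos_zeros (anchor_poly \<mu> d n))"
proof (intro conjI allI)
  note coeff = coeff_anchor_poly[OF assms(1-3,6,7)]
  fix n
  have fin: "finite {j. j * l \<le> n}"
    by (rule finite_subset[of _ "{..n}"]) (use assms(3) in \<open>auto intro: order_trans[rotated]\<close>)
  show "anchor_poly \<mu> d n =
      (\<Sum>j | j * l \<le> n. monom (of_nat ((d * (n - j * l)) choose j)) j)"
  proof (rule poly_eqI)
    fix j
    have "coeff (\<Sum>j | j * l \<le> n. monom (of_nat ((d * (n - j * l)) choose j)) j) j =
        (if j * l \<le> n then of_nat ((d * (n - j * l)) choose j) else (0 :: real))"
      using fin by (simp add: coeff_sum)
    \<comment> \<open>Outside the summation range \<open>j > 0\<close>, and the truncated upper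
      entry is 0.\<close>
    also have "\<dots> = of_nat ((d * (n - j * l)) choose j)"
      by (cases j) auto
    finally show "coeff (anchor_poly \<mu> d n) j =
        coeff (\<Sum>j | j * l \<le> n. monom (of_nat ((d * (n - j * l)) choose j)) j) j"
      by (simp add: coeff gap_choose_def diff_mult_distrib2 mult_ac)
  qed
  have "anchor_poly \<mu> d n = gap_poly (d * l) (d * n)"
    by (rule poly_eqI) (simp add: coeff coeff_gap_poly)
  then show "only_real_nonpos_zeros (anchor_poly \<mu> d n)"
    by (simp add: only_real_nonpos_zeros_gap_poly)
next
  show "brenti_sequence (\<lambda>n. anchor_poly \<mu> d n)"
    unfolding brenti_sequence_def
    \<comment> \<open>The row index \<open>d * n\<close> and the parameter \<open>d * l\<close> are
      those of \<open>coeff_anchor_poly\<close>.\<close>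
    by (intro exI[of _ "step_digraph (d * l)"] exI[of _ "\<lambda>_. 1"] exI[of _ "\<lambda>n. d * n"])
      (simp add: coeff_anchor_poly[OF assms(1-3,6,7)] weighted_paths_step_digraph
        locally_finite_step_digraph finite_path_sets_step_digraph planar_step_digraph
        weakly_y_invariant_step_digraph)
qed

end
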